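(* There exist (irreducible) $2$-step nilpotent Lie algebras in any dimension $4n$ for $n\geq2$ which admit a hypersymplectic structure, but admit no abelian hypersymplectic structure and no hypersymplectic structure of Kodaira type.
   Context: All Lie algebras are real and finite-dimensional. A Lie algebra is called irreducible (also: indecomposable) if it is not the direct sum of two nonzero ideals. A hypersymplectic structure on a Lie algebra $\mathfrak{g}$ is a triple $(g,J,E)$ where $g$ is a non-degenerate symmetric bilinear form on $\mathfrak{g}$, $J,E\in\mathrm{End}(\mathfrak{g})$, $J^2=-\mathrm{id}$, $E^2=\mathrm{id}$, $JE=-EJ$, $g(J\cdot,J\cdot)=g$, $g(E\cdot,E\cdot)=-g$, and both $J$ and $E$ are parallel for the Levi-Civita connection $\nabla$ of $g$ (given by $2g(\nabla_XY,Z)=g([X,Y],Z)-g(Y,[X,Z])-g(X,[Y,Z])$). The quadruple $(\mathfrak{g},g,J,E)$ is then called a hypersymplectic Lie algebra. A hypersymplectic structure is called abelian if $[JX,JY]=[X,Y]$ for all $X,Y\in\mathfrak{g}$ or $[EX,EY]=-[X,Y]$ for all $X,Y\in\mathfrak{g}$ (for hypersymplectic structures these two conditions are equivalent). A hypersymplectic Lie algebra $(\mathfrak{g},g,J,E)$ (or its hypersymplectic structure) is of Kodaira type if $\mathfrak{g}$ is $2$-step nilpotent and its center is $J$-invariant and has dimension $\frac12\dim\mathfrak{g}$. *)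

theory Defs
  imports "HOL-Analysis.Analysis"
begin

text \<open>
  A real finite-dimensional Lie algebra is a type of class \<open>euclidean_space\<close> with a bracket.
  The class only supplies the finite-dimensional real vector space: its inner product occurs in
  no definition below.
\<close>

locale lie_algebra =
  fixes br :: "'a::euclidean_space \<Rightarrow> 'a \<Rightarrow> 'a"
  assumes bilinear_br: "bilinear br"
    and br_self: "br x x = 0"
    and jacobi: "br x (br y z) + br y (br z x) + br z (br x y) = 0"

definition lie_ideal :: "('a::euclidean_space \<Rightarrow> 'a \<Rightarrow> 'a) \<Rightarrow> 'a set \<Rightarrow> bool" where
  "lie_ideal br I \<longleftrightarrow> subspace I \<and> (\<forall>x. \<forall>y\<in>I. br x y \<in> I)"

definition lie_irreducible :: "('a::euclidean_space \<Rightarrow> 'a \<Rightarrow> 'a) \<Rightarrow> bool" where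
  "lie_irreducible br \<longleftrightarrow>
     \<not> (\<exists>I K. lie_ideal br I \<and> lie_ideal br K \<and> I \<noteq> {0} \<and> K \<noteq> {0} \<and>
            I \<inter> K = {0} \<and> {x + y |x y. x \<in> I \<and> y \<in> K} = UNIV)"

definition lie_center :: "('a::euclidean_space \<Rightarrow> 'a \<Rightarrow> 'a) \<Rightarrow> 'a set" where
  "lie_center br = {x. \<forall>y. br x y = 0}"

text \<open>Nilpotency class exactly 2, so abelian Lie algebras are excluded.\<close>

definition two_step_nilpotent :: "('a::euclidean_space \<Rightarrow> 'a \<Rightarrow> 'a) \<Rightarrow> bool" where
  "two_step_nilpotent br \<longleftrightarrow> (\<exists>x y. br x y \<noteq> 0) \<and> (\<forall>x y z. br x (br y z) = 0)"

definition nondegenerate :: "('a::euclidean_space \<Rightarrow> 'a \<Rightarrow> real) \<Rightarrow> bool" where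
  "nondegenerate g \<longleftrightarrow> (\<forall>x. (\<forall>y. g x y = 0) \<longrightarrow> x = 0)"

text \<open>
  The Koszul formula for left-invariant vector fields; it determines a unique vector as soon as
  \<open>g\<close> is bilinear and non-degenerate, see \<open>levi_civita_koszul\<close> and \<open>levi_civita_unique\<close>.
\<close>

definition levi_civita ::
    "('a::euclidean_space \<Rightarrow> 'a \<Rightarrow> 'a) \<Rightarrow> ('a \<Rightarrow> 'a \<Rightarrow> real) \<Rightarrow> 'a \<Rightarrow> 'a \<Rightarrow> 'a" where
  "levi_civita br g x y =
     (THE w. \<forall>z. 2 * g w z = g (br x y) z - g y (br x z) - g x (br y z))"

text \<open>\<open>\<nabla>A = 0\<close>, where \<open>(\<nabla>\<^sub>x A) y = \<nabla>\<^sub>x (A y) - A (\<nabla>\<^sub>x y)\<close>.\<close>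

definition parallel ::
    "('a::euclidean_space \<Rightarrow> 'a \<Rightarrow> 'a) \<Rightarrow> ('a \<Rightarrow> 'a \<Rightarrow> real) \<Rightarrow> ('a \<Rightarrow> 'a) \<Rightarrow> bool" where
  "parallel br g A \<longleftrightarrow> (\<forall>x y. levi_civita br g x (A y) = A (levi_civita br g x y))"

definition hypersymplectic ::
    "('a::euclidean_space \<Rightarrow> 'a \<Rightarrow> 'a) \<Rightarrow> ('a \<Rightarrow> 'a \<Rightarrow> real) \<Rightarrow> ('a \<Rightarrow> 'a) \<Rightarrow> ('a \<Rightarrow> 'a) \<Rightarrow> bool" where
  "hypersymplectic br g J E \<longleftrightarrow>
     bilinear g \<and> (\<forall>x y. g x y = g y x) \<and> nondegenerate g \<and>
     linear J \<and> linear E \<and>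
     (\<forall>x. J (J x) = - x) \<and> (\<forall>x. E (E x) = x) \<and> (\<forall>x. J (E x) = - E (J x)) \<and>
     (\<forall>x y. g (J x) (J y) = g x y) \<and> (\<forall>x y. g (E x) (E y) = - g x y) \<and>
     parallel br g J \<and> parallel br g E"

definition abelian_hypersymplectic ::
    "('a::euclidean_space \<Rightarrow> 'a \<Rightarrow> 'a) \<Rightarrow> ('a \<Rightarrow> 'a \<Rightarrow> real) \<Rightarrow> ('a \<Rightarrow> 'a) \<Rightarrow> ('a \<Rightarrow> 'a) \<Rightarrow> bool" where
  "abelian_hypersymplectic br g J E \<longleftrightarrow>
     hypersymplectic br g J E \<and>
     ((\<forall>x y. br (J x) (J y) = br x y) \<or> (\<forall>x y. br (E x) (E y) = - br x y))"

definition Kodaira_type ::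
    "('a::euclidean_space \<Rightarrow> 'a \<Rightarrow> 'a) \<Rightarrow> ('a \<Rightarrow> 'a \<Rightarrow> real) \<Rightarrow> ('a \<Rightarrow> 'a) \<Rightarrow> ('a \<Rightarrow> 'a) \<Rightarrow> bool" where
  "Kodaira_type br g J E \<longleftrightarrow>
     hypersymplectic br g J E \<and> two_step_nilpotent br \<and>
     J ` lie_center br \<subseteq> lie_center br \<and>
     real (dim (lie_center br)) = DIM('a) / 2"

lemma nondegenerate_represents:
  fixes g :: "'a::euclidean_space \<Rightarrow> 'a \<Rightarrow> real"
  assumes g: "bilinear g" "nondegenerate g" and f: "linear f"
  shows "\<exists>!w. \<forall>z. g w z = f z"
proof -
  define A where "A w = (\<Sum>b\<in>Basis. g w b *\<^sub>R b)" for w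
  have A_b: "A w \<bullet> b = g w b" if "b \<in> Basis" for w b
    using that by (simp add: A_def inner_sum_left_Basis)
  have "linear A"
    by (rule linearI)
      (simp_all add: A_def bilinear_ladd[OF g(1)] bilinear_lmul[OF g(1)] scaleR_add_left
        sum.distrib scaleR_sum_right)
  have agree: "\<forall>z. h z = k z"
    if "linear h" "linear k" "\<And>b. b \<in> Basis \<Longrightarrow> h b = k b" for h k :: "'a \<Rightarrow> real"
    using linear_eq_stdbasis[OF that] by simp
  have lin: "linear (g w)" for w
    using g(1) by (simp add: bilinear_def)
  have inj: "w = w'" if "A w = A w'" for w w'
  proof -
    have "\<forall>z. g w z = g w' z"
      by (rule agree[OF lin lin]) (metis A_b that)
    then have "\<forall>z. g (w - w') z = 0"
      by (simp add: bilinear_lsub[OF g(1)])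
    then show ?thesis
      using g(2) by (auto simp: nondegenerate_def)
  qed
  have "surj A"
    by (rule linear_injective_imp_surjective[OF \<open>linear A\<close>]) (auto intro: injI inj)
  then obtain w where w: "A w = (\<Sum>b\<in>Basis. f b *\<^sub>R b)"
    by (metis surjD)
  have ex: "\<forall>z. g w z = f z"
  proof (rule agree[OF lin f])
    fix b :: 'a assume b: "b \<in> Basis"
    then have "g w b = A w \<bullet> b" by (simp add: A_b)
    also have "\<dots> = f b" using b by (simp add: w inner_sum_left_Basis)
    finally show "g w b = f b" .
  qed
  show ?thesis
  proof (rule ex1I)
    show "\<forall>z. g w z = f z" by (rule ex)
  next
    fix w' assume "\<forall>z. g w' z = f z"
    with ex show "w' = w"
      by - (rule inj, simp add: A_def)
  qed
qed

context
  fixes br :: "'a::euclidean_space \<Rightarrow> 'a \<Rightarrow> 'a" and g :: "'a \<Rightarrow> 'a \<Rightarrow> real"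
  assumes br: "bilinear br" and g: "bilinear g" "nondegenerate g"
begin

lemma koszul_ex1:
  "\<exists>!w. \<forall>z. 2 * g w z = g (br x y) z - g y (br x z) - g x (br y z)"
proof -
  have "linear (\<lambda>z. (g (br x y) z - g y (br x z) - g x (br y z)) / 2)"
    by (rule linearI)
      (simp_all add: bilinear_radd[OF g(1)] bilinear_rmul[OF g(1)]
        bilinear_radd[OF br] bilinear_rmul[OF br] field_simps)
  from nondegenerate_represents[OF g this] show ?thesis
    by (simp add: field_simps)
qed

lemma levi_civita_koszul:
  "2 * g (levi_civita br g x y) z = g (br x y) z - g y (br x z) - g x (br y z)"
  using theI'[OF koszul_ex1[of x y]] by (simp add: levi_civita_def)

lemma levi_civita_unique:
  assumes "\<And>z. 2 * g w z = g (br x y) z - g y (br x z) - g x (br y z)"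
  shows "levi_civita br g x y = w"
  unfolding levi_civita_def using assms by (intro the1_equality[OF koszul_ex1]) blast

end

end

theory Submission
  imports Defs
begin

text \<open>
  Both kinds of excluded structure make the center invariant under an endomorphism of square
  \<open>-id\<close>, hence even-dimensional: for an abelian structure this is
  \<open>abelian_hypersymplectic_center_invariant\<close>, for Kodaira type it is part of the definition. So
  it suffices to find, in every dimension \<open>4n\<close> with \<open>n \<ge> 2\<close>, an irreducible 2-step nilpotent
  hypersymplectic Lie algebra whose center has odd dimension; the one below has a center of
  dimension \<open>2n - 1\<close>.

  It lives on \<open>V \<oplus> JV\<close>, where \<open>V = L \<oplus> W\<close> is a symplectic space of dimension \<open>2n\<close>, with
  Lagrangian subspaces \<open>L\<close> and \<open>W\<close> and dual bases \<open>l\<^sub>i\<close>, \<open>w\<^sub>i\<close> for \<open>i < n\<close>. Suppose that a linear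
  map \<open>\<alpha>\<close> from \<open>V\<close> into the symplectic Lie algebra of \<open>V\<close> is given. For \<open>x = u + Jv\<close> put
  \<open>\<nabla>\<^sub>x(u' + Jv') = \<alpha>\<^sub>u u' + J \<alpha>\<^sub>u v'\<close>, and \<open>[x,y] = \<nabla>\<^sub>x y - \<nabla>\<^sub>y x\<close>. Then \<open>\<nabla>\<close> is torsion-free by
  construction, commutes with \<open>J\<close> and with the map \<open>E\<close> that is \<open>id\<close> on \<open>V\<close> and \<open>-id\<close> on \<open>JV\<close>, and
  preserves the neutral metric built from the symplectic form. As soon as the bracket satisfies
  the Jacobi identity, \<open>\<nabla>\<close> is therefore the Levi-Civita connection and the structure is
  hypersymplectic (\<open>hypersymplecticI\<close>).

  If every \<open>\<alpha>\<^sub>u\<close> kills \<open>L\<close> and maps \<open>W\<close> into \<open>L\<close>, it is a symmetric bilinear form on \<open>W\<close>. The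
  choice made here is
  \<open>\<alpha>\<^sub>u = u(l\<^sub>0) s + T(u\<^sub>W, -, -)\<close>, where \<open>u(l\<^sub>0)\<close> is the \<open>l\<^sub>0\<close>-coordinate of \<open>u\<close>, the form \<open>s\<close> is the
  sum of the squares of the \<open>w\<^sub>i\<close>-coordinates with \<open>i \<ge> 1\<close>, and \<open>T\<close> is the symmetric cubic form with
  \<open>T(w\<^sub>0,w\<^sub>1,w\<^sub>1) = 1\<close> as its only independent nonzero coefficient. The nonzero brackets are
  \<open>[l\<^sub>0,w\<^sub>i] = l\<^sub>i\<close>, \<open>[l\<^sub>0,Jw\<^sub>i] = Jl\<^sub>i\<close> for \<open>i \<ge> 1\<close>, \<open>[w\<^sub>0,Jw\<^sub>1] = [w\<^sub>1,Jw\<^sub>0] = Jl\<^sub>1\<close> and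
  \<open>[w\<^sub>1,Jw\<^sub>1] = Jl\<^sub>0\<close>. The term \<open>s\<close> takes the vector \<open>l\<^sub>0\<close> out of the center but not \<open>Jl\<^sub>0\<close>, which
  makes the dimension of the center odd; the term \<open>T\<close> ties the remaining pieces together, so that
  the Lie algebra is irreducible.

  Irreducibility is seen from centralizers (\<open>lie_irreducibleI\<close>). The components of a vector \<open>x\<close>
  in two complementary ideals centralize \<open>x\<close>; if one of them brackets onto the whole center,
  then its ideal contains the center and the other ideal is zero. For \<open>x = l\<^sub>0 + w\<^sub>1\<close> the
  centralizer is, modulo the center, spanned by \<open>x\<close> and \<open>w\<^sub>0\<close>, and all its elements with nonzero
  \<open>x\<close>-coefficient bracket onto the center; of two components of \<open>x\<close>, one has this property.
\<close>

section \<open>Invariant subspaces of a complex structure\<close>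

text \<open>
  A complex subspace has even real dimension. An invariant subspace \<open>T\<close> of \<open>S\<close> is enlarged by
  \<open>x\<close> and \<open>J x\<close> until it is \<open>S\<close>; each step adds two dimensions because \<open>J\<close> has no real
  eigenvalue on the quotient by \<open>T\<close>.
\<close>

lemma even_dim_invariant_complex_structure:
  fixes J :: "'a::euclidean_space \<Rightarrow> 'a"
  assumes J: "linear J" "\<And>x. J (J x) = - x"
    and S: "subspace S" "J ` S \<subseteq> S"
  shows "even (dim S)"
proof -
  have "even (dim S)"
    if "subspace T" "T \<subseteq> S" "J ` T \<subseteq> T" "even (dim T)" for T
    using that
  proof (induction "dim S - dim T" arbitrary: T rule: less_induct)
    case less
    show ?case
    proof (cases "T = S")
      case True
      with less.prems show ?thesis by simp
    next
      case False
      with less.prems obtain x where x: "x \<in> S" "x \<notin> T" by blast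
      have spT: "span T = T"
        using less.prems by (simp add: span_eq_iff)
      have Jx: "J x \<notin> span (insert x T)"
      proof
        assume "J x \<in> span (insert x T)"
        then obtain c where c: "J x - c *\<^sub>R x \<in> T"
          by (auto simp: span_insert spT)
        \<comment> \<open>Modulo \<open>T\<close> the vector \<open>x\<close> would be an eigenvector for \<open>c\<close>, but \<open>J\<^sup>2 = -1 \<noteq> c\<^sup>2\<close>.\<close>
        have T1: "J (J x - c *\<^sub>R x) \<in> T"
          using c less.prems by blast
        have "J (J x - c *\<^sub>R x) + c *\<^sub>R (J x - c *\<^sub>R x) = - (1 + c\<^sup>2) *\<^sub>R x"
          by (simp add: linear_diff[OF J(1)] linear_scale[OF J(1)] J(2) algebra_simps
              power2_eq_square)
        moreover have "J (J x - c *\<^sub>R x) + c *\<^sub>R (J x - c *\<^sub>R x) \<in> T"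
          using T1 c less.prems(1) by (intro subspace_add subspace_scale)
        ultimately have "- (1 + c\<^sup>2) *\<^sub>R x \<in> T" by simp
        moreover have "- (1 + c\<^sup>2) \<noteq> 0"
          by (metis add_pos_nonneg less_irrefl neg_equal_0_iff_equal zero_less_one
              zero_le_power2)
        ultimately have "x \<in> T"
          using less.prems(1) by (metis scaleR_one left_inverse scaleR_scaleR subspace_scale)
        with x show False by simp
      qed
      let ?T = "span (insert (J x) (insert x T))"
      have d: "dim ?T = dim T + 2"
        using Jx x by (simp add: dim_insert spT)
      have sub: "?T \<subseteq> S"
        using x less.prems S by (intro span_minimal) auto
      have "J ` ?T = span (J ` insert (J x) (insert x T))"
        by (rule linear_span_image[OF J(1), symmetric])
      also have "\<dots> \<subseteq> ?T"
      proof (rule span_minimal)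
        show "J ` insert (J x) (insert x T) \<subseteq> ?T"
          using less.prems(3) by (auto simp: J(2) intro: span_base span_neg)
      qed simp
      finally have inv: "J ` ?T \<subseteq> ?T" .
      have "dim ?T \<le> dim S" using sub by (rule dim_subset)
      with d have "dim S - dim ?T < dim S - dim T" by linarith
      from less.hyps[OF this _ sub inv] d less.prems(4) show ?thesis
        by simp
    qed
  qed
  from this[of "{0}"] S show ?thesis
    using linear_0[OF J(1)] by (auto simp: subspace_0)
qed

lemma (in lie_algebra) bracket_simps:
  shows "br (x + y) z = br x z + br y z" "br x (y + z) = br x y + br x z"
    "br (x - y) z = br x z - br y z" "br x (y - z) = br x y - br x z"
    "br (- x) y = - br x y" "br x (- y) = - br x y" "br 0 x = 0" "br x 0 = 0"
  using bilinear_br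
  by (simp_all add: bilinear_ladd bilinear_radd bilinear_lsub bilinear_rsub bilinear_lneg
      bilinear_rneg bilinear_lzero bilinear_rzero)

lemma (in lie_algebra) bracket_antisym: "br x y = - br y x"
proof -
  have "br (x + y) (x + y) = br x y + br y x"
    unfolding bracket_simps by (simp add: br_self)
  then show ?thesis by (simp add: br_self eq_neg_iff_add_eq_0)
qed

lemma (in lie_algebra) subspace_lie_center: "subspace (lie_center br)"
  using bilinear_br
  by (auto simp: subspace_def lie_center_def bracket_simps bilinear_lmul)

section \<open>Abelian hypersymplectic structures\<close>

lemma (in lie_algebra) levi_civita_torsion_free:
  assumes g: "bilinear g" "nondegenerate g" "\<And>x y. g x y = g y x"
  shows "levi_civita br g x y - levi_civita br g y x = br x y"
proof -
  have "g (levi_civita br g x y - levi_civita br g y x - br x y) z = 0" for z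
  proof -
    have "g (br y x) z = - g (br x y) z"
      by (subst bracket_antisym) (simp add: bilinear_lneg[OF g(1)])
    then show ?thesis
      using levi_civita_koszul[OF bilinear_br g(1,2), of x y z]
        levi_civita_koszul[OF bilinear_br g(1,2), of y x z]
      by (simp add: bilinear_lsub[OF g(1)])
  qed
  with g(2) show ?thesis
    unfolding nondegenerate_def by (metis eq_iff_diff_eq_0)
qed

text \<open>
  The Nijenhuis tensor of \<open>J\<close> vanishes because a torsion-free connection preserves \<open>J\<close>: writing
  every bracket as \<open>\<nabla>\<^sub>x y - \<nabla>\<^sub>y x\<close> and moving \<open>J\<close> through \<open>\<nabla>\<close>, the terms cancel.
\<close>

lemma (in lie_algebra) hypersymplectic_integrable:
  assumes "hypersymplectic br g J E"
  shows "br (J x) (J y) = br x y + J (br (J x) y) + J (br x (J y))"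
proof -
  let ?D = "levi_civita br g"
  have J: "linear J" "\<And>x. J (J x) = - x" "\<And>x y. ?D x (J y) = J (?D x y)"
    and g: "bilinear g" "nondegenerate g" "\<And>x y. g x y = g y x"
    using assms by (auto simp: hypersymplectic_def parallel_def)
  have t: "br x y = ?D x y - ?D y x" for x y
    using levi_civita_torsion_free[OF g] by simp
  show ?thesis
    by (simp add: t J linear_diff[OF J(1)])
qed

text \<open>
  If \<open>[Jx,Jy] = [x,y]\<close>, then \<open>[Jx,y] = -[x,Jy]\<close>, so \<open>J\<close> preserves the center. The condition on
  \<open>E\<close> implies the one on \<open>J\<close>: it says that the two eigenspaces of \<open>E\<close>, which \<open>J\<close> interchanges,
  are abelian, and integrability of \<open>J\<close> then gives the identity for mixed pairs.
\<close>

lemma (in lie_algebra) abelian_hypersymplectic_center_invariant: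
  assumes "abelian_hypersymplectic br g J E"
  shows "J ` lie_center br \<subseteq> lie_center br"
proof -
  have hs: "hypersymplectic br g J E"
    using assms by (simp add: abelian_hypersymplectic_def)
  then have J: "linear J" "\<And>x. J (J x) = - x"
    and E: "linear E" "\<And>x. E (E x) = x" "\<And>x. J (E x) = - E (J x)"
    by (auto simp: hypersymplectic_def)
  have "br (J x) (J y) = br x y" if ab: "\<And>x y. br (E x) (E y) = - br x y" for x y
  proof -
    have EJ: "E (J x) = - J (E x)" for x using E(3)[of x] by simp
    have plus: "br u v = 0" if "E u = u" "E v = v" for u v
    proof -
      have "2 *\<^sub>R br u v = 0"
        using ab[of u v] that by (simp add: scaleR_2 eq_neg_iff_add_eq_0)
      then show ?thesis by simp
    qed
    have minus: "br u v = 0" if "E u = - u" "E v = - v" for u v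
    proof -
      have "2 *\<^sub>R br u v = 0"
        using ab[of u v] that by (simp add: bracket_simps scaleR_2 eq_neg_iff_add_eq_0)
      then show ?thesis by simp
    qed
    have mixed: "br (J u) v = - br u (J v)" if "E u = u" "E v = v" for u v
    proof -
      have "br (J u) (J v) = 0"
        using that by (intro minus) (simp_all add: EJ)
      then have "J (br (J u) v + br u (J v)) = 0"
        using hypersymplectic_integrable[OF hs, of u v] plus[OF that]
        by (simp add: linear_add[OF J(1)])
      then have "J (J (br (J u) v + br u (J v))) = 0"
        using linear_0[OF J(1)] by simp
      then have "br (J u) v + br u (J v) = 0"
        by (simp only: J(2) neg_equal_0_iff_equal)
      then show ?thesis by (rule eq_neg_iff_add_eq_0[THEN iffD2])
    qed
    let ?p = "\<lambda>x. (1/2) *\<^sub>R (x + E x)"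
    have p: "E (?p x) = ?p x" for x
      by (simp add: linear_scale[OF E(1)] linear_add[OF E(1)] E(2) add.commute)
    \<comment> \<open>Splitting into the two eigenspaces of \<open>E\<close>, the second one written as \<open>J\<close> of the first.\<close>
    have dec: "\<exists>u v. E u = u \<and> E v = v \<and> x = u + J v" for x
    proof (intro exI conjI)
      have "J (?p (- J x)) = (1/2) *\<^sub>R (x - E x)"
        by (simp add: linear_neg[OF E(1)] linear_scale[OF J(1)] linear_add[OF J(1)]
            linear_diff[OF J(1)] linear_neg[OF J(1)] J(2) EJ)
      then have "?p x + J (?p (- J x)) = (1/2 + 1/2) *\<^sub>R x"
        unfolding scaleR_add_left by (simp add: scaleR_add_right scaleR_diff_right)
      then show "x = ?p x + J (?p (- J x))" by simp
    qed (rule p)+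
    obtain u v where x: "E u = u" "E v = v" "x = u + J v" using dec by metis
    obtain u' v' where y: "E u' = u'" "E v' = v'" "y = u' + J v'" using dec by metis
    have z: "br (J v) (J v') = 0" "br (J u) (J u') = 0"
      using x y by (auto intro!: minus simp: EJ)
    show ?thesis
      using mixed[OF x(1) y(2)] mixed[OF x(2) y(1)] plus[OF x(1) y(1)] plus[OF x(2) y(2)] z
      by (simp add: x(3) y(3) linear_add[OF J(1)] J(2) bracket_simps)
  qed
  then have ab: "br (J x) (J y) = br x y" for x y
    using assms by (auto simp: abelian_hypersymplectic_def)
  show ?thesis
  proof (clarsimp simp: lie_center_def)
    fix x y assume "\<forall>y. br x y = 0"
    then show "br (J x) y = 0"
      using ab[of x "- J y"] by (simp add: linear_neg[OF J(1)] J(2))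
  qed
qed

section \<open>Recognising hypersymplectic structures\<close>

text \<open>
  A torsion-free metric connection satisfies the Koszul formula, so it is the Levi-Civita
  connection, and parallelism can be checked on it.
\<close>

lemma (in lie_algebra) hypersymplecticI:
  assumes g: "bilinear g" "\<And>x y. g x y = g y x" "nondegenerate g"
    and JE: "linear J" "linear E" "\<And>x. J (J x) = - x" "\<And>x. E (E x) = x"
      "\<And>x. J (E x) = - E (J x)"
      "\<And>x y. g (J x) (J y) = g x y" "\<And>x y. g (E x) (E y) = - g x y"
    and torsion: "\<And>x y. br x y = D x y - D y x"
    and metric: "\<And>x y z. g (D x y) z = - g y (D x z)"
    and par: "\<And>x y. D x (J y) = J (D x y)" "\<And>x y. D x (E y) = E (D x y)"
  shows "hypersymplectic br g J E"
proof -
  have "levi_civita br g x y = D x y" for x y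
  proof (rule levi_civita_unique[OF bilinear_br g(1,3)])
    fix z
    show "2 * g (D x y) z = g (br x y) z - g y (br x z) - g x (br y z)"
      using metric[of x y z] metric[of y x z] metric[of z x y] g(2)[of "D z x" y]
      by (simp add: torsion bilinear_lsub[OF g(1)] bilinear_rsub[OF g(1)])
  qed
  then show ?thesis
    using g JE par by (auto simp: hypersymplectic_def parallel_def)
qed

section \<open>Irreducibility\<close>

text \<open>
  In a decomposition into ideals \<open>I\<close> and \<open>K\<close> the components \<open>y\<close> and \<open>x - y\<close> of \<open>x\<close> commute with
  \<open>x\<close>. If \<open>y \<in> I\<close> brackets onto the center, then the center lies in \<open>I\<close>. The brackets of \<open>K\<close>
  with itself are central by nilpotency, hence lie in \<open>I \<inter> K = {0}\<close>; so \<open>K\<close> is central, which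
  puts it inside \<open>I\<close> as well.
\<close>

lemma (in lie_algebra) lie_irreducibleI:
  assumes nil: "\<And>x y z. br x (br y z) = 0"
    and x: "\<And>y. br x y = 0 \<Longrightarrow>
      lie_center br \<subseteq> range (br y) \<or> lie_center br \<subseteq> range (br (x - y))"
  shows "lie_irreducible br"
proof -
  have trivial: "K \<subseteq> {0}"
    if I: "lie_ideal br I" and K: "lie_ideal br K" and IK: "I \<inter> K = {0}"
      and sum: "\<And>z. \<exists>u\<in>I. \<exists>v\<in>K. z = u + v"
      and y: "y \<in> I" "lie_center br \<subseteq> range (br y)" for I K y
  proof -
    have "br y u \<in> I" for u
      using I y(1) bracket_antisym[of y u] by (simp add: lie_ideal_def subspace_neg)
    with y(2) have Z: "lie_center br \<subseteq> I" by auto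
    have "k = 0" if k: "k \<in> K" for k
    proof -
      have "br k z = 0" for z
      proof -
        obtain u v where uv: "u \<in> I" "v \<in> K" "z = u + v" using sum by blast
        have 1: "br k u \<in> I" "br k v \<in> K"
          using I K uv k by (auto simp: lie_ideal_def)
        have "br u k \<in> K" using K k by (auto simp: lie_ideal_def)
        then have 2: "br k u \<in> K"
          using K bracket_antisym[of k u] by (simp add: lie_ideal_def subspace_neg)
        have "br k v \<in> lie_center br"
          using nil bracket_antisym[of "br k v"] by (simp add: lie_center_def)
        with Z have "br k v \<in> I" by blast
        with 1 2 IK have "br k u = 0" "br k v = 0" by blast+
        then show ?thesis by (simp add: uv(3) bracket_simps)
      qed
      then have "k \<in> I" using Z by (auto simp: lie_center_def)
      with k IK show ?thesis by blast
    qed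
    then show ?thesis by blast
  qed
  show ?thesis
    unfolding lie_irreducible_def
  proof clarify
    fix I K
    assume I: "lie_ideal br I" and K: "lie_ideal br K" and ne: "I \<noteq> {0}" "K \<noteq> {0}"
      and IK: "I \<inter> K = {0}" and sum: "{x + y |x y. x \<in> I \<and> y \<in> K} = UNIV"
    have s: "\<exists>u\<in>I. \<exists>v\<in>K. z = u + v" for z using sum by blast
    have s': "\<exists>u\<in>K. \<exists>v\<in>I. z = u + v" for z using s[of z] by (metis add.commute)
    obtain u v where uv: "u \<in> I" "v \<in> K" "x = u + v" using s by blast
    have "br v u \<in> I" using I uv by (auto simp: lie_ideal_def)
    moreover have "br v u \<in> K"
      using K uv bracket_antisym[of v u] by (auto simp: lie_ideal_def subspace_neg)
    ultimately have "br v u = 0" using IK by blast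
    then have "br x u = 0" by (simp add: uv(3) bracket_simps br_self)
    from x[OF this] uv(3)
    have "lie_center br \<subseteq> range (br u) \<or> lie_center br \<subseteq> range (br v)" by simp
    then have "K \<subseteq> {0} \<or> I \<subseteq> {0}"
      using trivial[OF I K IK s uv(1)] trivial[OF K I _ s' uv(2)] IK by blast
    moreover have "0 \<in> I" "0 \<in> K" using IK by auto
    ultimately show False using ne by blast
  qed
qed

section \<open>The Lie algebra\<close>

datatype block = L | W | JL | JW

lemma UNIV_block: "UNIV = {L, W, JL, JW}"
  using block.exhaust by auto

text \<open>
  An index of \<open>real ^ 'n\<close> is identified with a pair \<open>(b, i)\<close>, which numbers the vectors \<open>l\<^sub>i\<close>,
  \<open>w\<^sub>i\<close>, \<open>Jl\<^sub>i\<close>, \<open>Jw\<^sub>i\<close> of a basis of \<open>V \<oplus> JV\<close> by their block and their position in it.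
\<close>

locale block_coordinates =
  fixes n :: nat and h :: "'n::finite \<Rightarrow> block \<times> nat"
  assumes n: "n \<ge> 2" and h: "bij_betw h UNIV (UNIV \<times> {..<n})"
begin

definition crd :: "real ^ 'n \<Rightarrow> block \<Rightarrow> nat \<Rightarrow> real" where
  "crd x b i = x $ inv_into UNIV h (b, i)"

definition assemble :: "(block \<Rightarrow> nat \<Rightarrow> real) \<Rightarrow> real ^ 'n" where
  "assemble F = (\<chi> j. case h j of (b, i) \<Rightarrow> F b i)"

lemma crd_simps [simp]:
  "crd (x + y) b i = crd x b i + crd y b i" "crd (x - y) b i = crd x b i - crd y b i"
  "crd (- x) b i = - crd x b i" "crd (r *\<^sub>R x) b i = r * crd x b i" "crd 0 b i = 0"
  by (simp_all add: crd_def)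

lemma crd_assemble [simp]: "i < n \<Longrightarrow> crd (assemble F) b i = F b i"
  using bij_betw_inv_into_right[OF h, of "(b, i)"] by (simp add: crd_def assemble_def)

lemma crd_eqI:
  assumes "\<And>b i. i < n \<Longrightarrow> crd x b i = crd y b i"
  shows "x = y"
proof -
  have "x $ j = y $ j" for j
  proof -
    obtain b i where bi: "h j = (b, i)" by fastforce
    then have "i < n" using bij_betw_apply[OF h, of j] by simp
    moreover have "inv_into UNIV h (b, i) = j"
      using bi bij_betw_inv_into_left[OF h, of j] by simp
    ultimately show ?thesis using assms[of i b] by (simp add: crd_def)
  qed
  then show ?thesis by (simp add: vec_eq_iff)
qed

lemma indices [simp]: "0 < n" "Suc 0 < n"
  using n by auto

text \<open>
  The map \<open>\<alpha>\<^sub>x\<close> from \<open>W\<close> to \<open>L\<close>, applied to the vector of \<open>W\<close> with coordinates \<open>v\<close>; it depends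
  only on the \<open>V\<close>-component of \<open>x\<close>. The factor \<open>crd x L 0\<close> belongs to the form \<open>s\<close>, the products
  with the \<open>W\<close>-coordinates of \<open>x\<close> are the cubic form \<open>T\<close>.
\<close>

definition act :: "real ^ 'n \<Rightarrow> (nat \<Rightarrow> real) \<Rightarrow> nat \<Rightarrow> real" where
  "act x v i =
     (if i = 0 then crd x W 1 * v 1
      else crd x L 0 * v i + (if i = 1 then crd x W 0 * v 1 + crd x W 1 * v 0 else 0))"

definition conn :: "real ^ 'n \<Rightarrow> real ^ 'n \<Rightarrow> real ^ 'n" where
  "conn x y = assemble (\<lambda>b i. case b of
     L \<Rightarrow> act x (crd y W) i | JL \<Rightarrow> act x (crd y JW) i | W \<Rightarrow> 0 | JW \<Rightarrow> 0)"

definition brk :: "real ^ 'n \<Rightarrow> real ^ 'n \<Rightarrow> real ^ 'n" where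
  "brk x y = conn x y - conn y x"

text \<open>
  With \<open>\<omega>\<close> the symplectic form pairing \<open>L\<close> with \<open>W\<close>, this is
  \<open>\<omega>(u,v') - \<omega>(v,u')\<close> on \<open>u + Jv\<close> and \<open>u' + Jv'\<close>.
\<close>

definition metr :: "real ^ 'n \<Rightarrow> real ^ 'n \<Rightarrow> real" where
  "metr x y = (\<Sum>i<n. crd x L i * crd y JW i - crd x W i * crd y JL i
                     - crd x JL i * crd y W i + crd x JW i * crd y L i)"

definition jmap :: "real ^ 'n \<Rightarrow> real ^ 'n" where
  "jmap x = assemble (\<lambda>b. case b of
     L \<Rightarrow> - crd x JL | W \<Rightarrow> - crd x JW | JL \<Rightarrow> crd x L | JW \<Rightarrow> crd x W)"

definition emap :: "real ^ 'n \<Rightarrow> real ^ 'n" where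
  "emap x = assemble (\<lambda>b. case b of
     L \<Rightarrow> crd x L | W \<Rightarrow> crd x W | JL \<Rightarrow> - crd x JL | JW \<Rightarrow> - crd x JW)"

lemma crd_conn [simp]:
  "i < n \<Longrightarrow> crd (conn x y) L i = act x (crd y W) i"
  "i < n \<Longrightarrow> crd (conn x y) JL i = act x (crd y JW) i"
  "i < n \<Longrightarrow> crd (conn x y) W i = 0"
  "i < n \<Longrightarrow> crd (conn x y) JW i = 0"
  by (simp_all add: conn_def)

lemma crd_jmap [simp]:
  "i < n \<Longrightarrow> crd (jmap x) L i = - crd x JL i"
  "i < n \<Longrightarrow> crd (jmap x) W i = - crd x JW i"
  "i < n \<Longrightarrow> crd (jmap x) JL i = crd x L i"
  "i < n \<Longrightarrow> crd (jmap x) JW i = crd x W i"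
  by (simp_all add: jmap_def)

lemma crd_emap [simp]:
  "i < n \<Longrightarrow> crd (emap x) L i = crd x L i"
  "i < n \<Longrightarrow> crd (emap x) W i = crd x W i"
  "i < n \<Longrightarrow> crd (emap x) JL i = - crd x JL i"
  "i < n \<Longrightarrow> crd (emap x) JW i = - crd x JW i"
  by (simp_all add: emap_def)

lemma crd_brk [simp]:
  "crd (brk x y) L 0 = 0"
  "i \<noteq> 0 \<Longrightarrow> i < n \<Longrightarrow> crd (brk x y) L i = crd x L 0 * crd y W i - crd y L 0 * crd x W i"
  "i < n \<Longrightarrow> crd (brk x y) JL i = act x (crd y JW) i - act y (crd x JW) i"
  "i < n \<Longrightarrow> crd (brk x y) W i = 0"
  "i < n \<Longrightarrow> crd (brk x y) JW i = 0"
  by (simp_all add: brk_def act_def)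

lemma bilinear_brk: "bilinear brk"
  unfolding bilinear_def
proof safe
  fix x
  show "linear (brk x)"
  proof (rule linearI)
    fix y z r
    show "brk x (y + z) = brk x y + brk x z"
    proof (rule crd_eqI)
      fix b i assume "i < n"
      then show "crd (brk x (y + z)) b i = crd (brk x y + brk x z) b i"
        by (cases b; cases "i = 0") (simp_all add: act_def algebra_simps)
    qed
    show "brk x (r *\<^sub>R y) = r *\<^sub>R brk x y"
    proof (rule crd_eqI)
      fix b i assume "i < n"
      then show "crd (brk x (r *\<^sub>R y)) b i = crd (r *\<^sub>R brk x y) b i"
        by (cases b; cases "i = 0") (simp_all add: act_def algebra_simps)
    qed
  qed
next
  fix x
  show "linear (\<lambda>y. brk y x)"
  proof (rule linearI)
    fix y z r
    show "brk (y + z) x = brk y x + brk z x"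
    proof (rule crd_eqI)
      fix b i assume "i < n"
      then show "crd (brk (y + z) x) b i = crd (brk y x + brk z x) b i"
        by (cases b; cases "i = 0") (simp_all add: act_def algebra_simps)
    qed
    show "brk (r *\<^sub>R y) x = r *\<^sub>R brk y x"
    proof (rule crd_eqI)
      fix b i assume "i < n"
      then show "crd (brk (r *\<^sub>R y) x) b i = crd (r *\<^sub>R brk y x) b i"
        by (cases b; cases "i = 0") (simp_all add: act_def algebra_simps)
    qed
  qed
qed

lemma brk_eq_0:
  assumes "crd y L 0 = 0" "\<And>i. i < n \<Longrightarrow> crd y W i = 0" "\<And>i. i < n \<Longrightarrow> crd y JW i = 0"
  shows "brk x y = 0" "brk y x = 0"
proof -
  show "brk x y = 0"
  proof (rule crd_eqI)
    fix b i assume "i < n"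
    then show "crd (brk x y) b i = crd 0 b i"
      using assms by (cases b; cases "i = 0") (simp_all add: act_def)
  qed
  then show "brk y x = 0" by (simp add: brk_def)
qed

text \<open>
  A bracket has no \<open>l\<^sub>0\<close>-coordinate, because \<open>s\<close> takes values in the span of the \<open>l\<^sub>i\<close> with
  \<open>i \<ge> 1\<close> while the contribution of \<open>T\<close> to the \<open>V\<close>-component cancels by symmetry. As brackets
  have no \<open>W\<close>- and \<open>JW\<close>-coordinates either, they are central, and the Jacobi identity is trivial.
\<close>

lemma brk_brk: "brk x (brk y z) = 0"
  by (rule brk_eq_0) simp_all

sublocale lie_algebra brk
  by unfold_locales (simp_all add: bilinear_brk brk_brk, simp add: brk_def)

section \<open>Center and irreducibility\<close>

text \<open>
  The vector \<open>l\<^sub>0 + w\<^sub>1\<close>. Adding \<open>w\<^sub>1\<close> to \<open>l\<^sub>0\<close> makes the symmetric form \<open>\<alpha>\<close> nondegenerate: the form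
  \<open>s\<close> of \<open>l\<^sub>0\<close> has kernel \<open>w\<^sub>0\<close>, and the form of \<open>w\<^sub>1\<close> pairs \<open>w\<^sub>0\<close> with \<open>w\<^sub>1\<close>.
\<close>

definition pivot :: "real ^ 'n" where
  "pivot = assemble (\<lambda>b i. if b = L \<and> i = 0 \<or> b = W \<and> i = 1 then 1 else 0)"

lemma crd_pivot [simp]: "i < n \<Longrightarrow> crd pivot b i = (if b = L \<and> i = 0 \<or> b = W \<and> i = 1 then 1 else 0)"
  by (simp add: pivot_def)

lemma centralizer_pivot:
  assumes "brk pivot y = 0" "i < n"
  shows "i \<noteq> 0 \<Longrightarrow> crd y W i = (if i = 1 then crd y L 0 else 0)" "crd y JW i = 0"
proof -
  have z: "crd (brk pivot y) b i = 0" if "i < n" for b i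
    using assms by simp
  show "crd y W i = (if i = 1 then crd y L 0 else 0)" if "i \<noteq> 0"
    using z[of i L] that assms(2) by (simp split: if_splits)
  \<comment> \<open>The \<open>JL\<close>-part says that \<open>\<alpha>\<close> at the pivot kills the \<open>JW\<close>-part of \<open>y\<close>. This system is
    triangular if the unknowns are taken in the order \<open>1, 0\<close>, then all others.\<close>
  have 1: "crd y JW 1 = 0"
    using z[of 0 JL] by (simp add: act_def)
  have 0: "crd y JW 0 = 0"
    using z[of 1 JL] 1 by (simp add: act_def)
  show "crd y JW i = 0"
    using z[of i JL] 0 1 assms(2) by (cases "i = 0"; cases "i = 1") (simp_all add: act_def)
qed

lemma center_iff:
  "y \<in> lie_center brk \<longleftrightarrow>
     crd y L 0 = 0 \<and> (\<forall>i<n. crd y W i = 0) \<and> (\<forall>i<n. crd y JW i = 0)"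
proof
  assume y: "y \<in> lie_center brk"
  then have y0: "brk y x = 0" "brk x y = 0" for x
    using bracket_antisym[of x y] by (simp_all add: lie_center_def)
  note c = centralizer_pivot[OF y0(2)]
  have z: "crd (brk y x) JL i = 0" if "i < n" for x i
    using y0(1) by simp
  \<comment> \<open>What commutes with the pivot has \<open>w\<^sub>1\<close>-coordinate equal to its \<open>l\<^sub>0\<close>-coordinate;
    bracketing with \<open>Jw\<^sub>0\<close> and then \<open>Jw\<^sub>1\<close> removes what is left.\<close>
  have "crd y W 1 = 0"
    using z[of 1 "assemble (\<lambda>b i. if b = JW \<and> i = 0 then 1 else 0)"] by (simp add: act_def)
  then have L: "crd y L 0 = 0" using c(1)[of 1] by simp
  have "crd y W 0 = 0"
    using z[of 1 "assemble (\<lambda>b i. if b = JW \<and> i = 1 then 1 else 0)"] L by (simp add: act_def)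
  then have "crd y W i = 0" if "i < n" for i
    using c(1)[OF that] L by (cases "i = 0") auto
  with L c(2) show "crd y L 0 = 0 \<and> (\<forall>i<n. crd y W i = 0) \<and> (\<forall>i<n. crd y JW i = 0)"
    by blast
next
  assume "crd y L 0 = 0 \<and> (\<forall>i<n. crd y W i = 0) \<and> (\<forall>i<n. crd y JW i = 0)"
  then show "y \<in> lie_center brk"
    by (auto simp: lie_center_def intro!: brk_eq_0)
qed

lemma dim_center: "dim (lie_center brk) = 2 * n - 1"
proof -
  let ?B = "{L} \<times> {1..<n} \<union> {JL} \<times> {..<n}"
  let ?d = "inv_into UNIV h ` ?B"
  have inv: "inv_into UNIV h (b, i) \<in> ?d \<longleftrightarrow> (b, i) \<in> ?B" if "i < n" for b i
    using that by (force dest: inv_into_injective simp: bij_betw_imp_surj_on[OF h])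
  have "lie_center brk = {x. \<forall>j. j \<notin> ?d \<longrightarrow> x $ j = 0}"
  proof (intro set_eqI)
    fix x :: "real ^ 'n"
    have "(\<forall>j. j \<notin> ?d \<longrightarrow> x $ j = 0) \<longleftrightarrow> (\<forall>b. \<forall>i<n. (b, i) \<notin> ?B \<longrightarrow> crd x b i = 0)"
    proof (intro iffI allI impI)
      fix b i assume "\<forall>j. j \<notin> ?d \<longrightarrow> x $ j = 0" "i < n" "(b, i) \<notin> ?B"
      then show "crd x b i = 0" unfolding crd_def using inv[of i b] by blast
    next
      fix j assume *: "\<forall>b. \<forall>i<n. (b, i) \<notin> ?B \<longrightarrow> crd x b i = 0" and j: "j \<notin> ?d"
      obtain b i where bi: "h j = (b, i)" by fastforce
      then have i: "i < n" using bij_betw_apply[OF h, of j] by simp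
      have e: "inv_into UNIV h (b, i) = j"
        using bi bij_betw_inv_into_left[OF h, of j] by simp
      have "(b, i) \<notin> ?B" using inv[OF i, of b] j e by simp
      then show "x $ j = 0" using * i e by (metis crd_def)
    qed
    also have "\<dots> \<longleftrightarrow> x \<in> lie_center brk"
      unfolding center_iff
    proof (intro iffI conjI allI impI)
      fix b i
      assume "crd x L 0 = 0 \<and> (\<forall>i<n. crd x W i = 0) \<and> (\<forall>i<n. crd x JW i = 0)"
        "i < n" "(b, i) \<notin> ?B"
      then show "crd x b i = 0" by (cases b; cases "i = 0") auto
    qed auto
    finally show "x \<in> lie_center brk \<longleftrightarrow> x \<in> {x. \<forall>j. j \<notin> ?d \<longrightarrow> x $ j = 0}" by simp
  qed
  then have "dim (lie_center brk) = card ?d"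
    by (simp only: dim_vec_eq[symmetric] dim_substandard_cart)
  also have "\<dots> = card ?B"
  proof (rule card_image)
    have "inj_on (inv_into UNIV h) (UNIV \<times> {..<n})"
      using bij_betw_inv_into[OF h] by (rule bij_betw_imp_inj_on)
    then show "inj_on (inv_into UNIV h) ?B" by (rule inj_on_subset) auto
  qed
  also have "\<dots> = 2 * n - 1"
    using n by (subst card_Un_disjoint) (auto simp: card_cartesian_product)
  finally show ?thesis .
qed

text \<open>
  Modulo the center \<open>y\<close> is \<open>a (l\<^sub>0 + w\<^sub>1) + c w\<^sub>0\<close> with \<open>a \<noteq> 0\<close>. Brackets with \<open>w\<^sub>i\<close>, \<open>i \<ge> 1\<close>, give
  the multiples of \<open>l\<^sub>i\<close>, and brackets with \<open>JW\<close> give all of \<open>JL\<close>: the determinant of \<open>\<alpha>\<^sub>y\<close> does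
  not depend on \<open>c\<close>, since \<open>c\<close> enters only the entry \<open>(1,1)\<close> of the block
  \<open>(0, a; a, a + c)\<close> of the indices \<open>0\<close> and \<open>1\<close>.
\<close>

lemma center_subset_range:
  assumes y: "brk pivot y = 0" "crd y L 0 \<noteq> 0"
  shows "lie_center brk \<subseteq> range (brk y)"
proof
  fix z assume z: "z \<in> lie_center brk"
  let ?a = "crd y L 0"
  \<comment> \<open>The solution of the linear system \<open>[y,u] = z\<close>, with \<open>c = crd y W 0\<close>.\<close>
  define u where "u = assemble (\<lambda>b i. case b of
      W \<Rightarrow> if i = 0 then 0 else crd z L i / ?a
    | JW \<Rightarrow> if i = 0 then (crd z JL 1 - crd z JL 0 - crd y W 0 * crd z JL 0 / ?a) / ?a
            else if i = 1 then crd z JL 0 / ?a else crd z JL i / ?a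
    | _ \<Rightarrow> 0)"
  have "z = brk y u"
  proof (rule crd_eqI)
    fix b i assume i: "i < n"
    note c = centralizer_pivot[OF y(1)]
    have u: "crd u L 0 = 0" by (simp add: u_def)
    have w: "crd y W 1 = ?a" using c(1)[of 1] by simp
    show "crd z b i = crd (brk y u) b i"
      using z i y(2) u w
      by (cases b; cases "i = 0"; cases "i = 1")
        (simp_all add: center_iff u_def act_def c field_simps)
  qed
  then show "z \<in> range (brk y)" by blast
qed

lemma irreducible: "lie_irreducible brk"
proof (rule lie_irreducibleI[OF brk_brk])
  fix y assume y: "brk pivot y = 0"
  then have y': "brk pivot (pivot - y) = 0" by (simp add: bracket_simps br_self)
  \<comment> \<open>The two \<open>l\<^sub>0\<close>-coordinates add up to \<open>1\<close>.\<close>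
  have "crd y L 0 \<noteq> 0 \<or> crd (pivot - y) L 0 \<noteq> 0" by auto
  then show "lie_center brk \<subseteq> range (brk y) \<or> lie_center brk \<subseteq> range (brk (pivot - y))"
    using center_subset_range[OF y] center_subset_range[OF y'] by blast
qed

lemma two_step: "two_step_nilpotent brk"
proof -
  have "pivot \<notin> lie_center brk" by (simp add: center_iff)
  then show ?thesis
    by (auto simp: two_step_nilpotent_def lie_center_def brk_brk)
qed

section \<open>The hypersymplectic structure\<close>

text \<open>
  \<open>\<alpha>\<^sub>x\<close> is a symmetric bilinear form on \<open>W\<close>; equivalently it lies in the symplectic Lie algebra
  of \<open>V\<close>, which is what makes the connection metric.
\<close>

lemma act_symmetric: "(\<Sum>i<n. act x v i * w i) = (\<Sum>i<n. v i * act x w i)"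
proof -
  obtain m where m: "n = Suc (Suc m)"
    using n by (metis add_2_eq_Suc le_Suc_ex)
  have s: "(\<Sum>i<n. f i) = f 0 + f 1 + (\<Sum>i<m. f (Suc (Suc i)))" for f :: "nat \<Rightarrow> real"
    by (simp add: m sum.lessThan_Suc_shift del: sum.lessThan_Suc)
  show ?thesis
    unfolding s by (simp add: act_def algebra_simps)
qed

lemma bilinear_metr: "bilinear metr"
  unfolding bilinear_def
  by (auto intro!: linearI simp: metr_def algebra_simps sum.distrib sum_subtractf sum_distrib_left)

lemma nondegenerate_metr: "nondegenerate metr"
  unfolding nondegenerate_def
proof (intro allI impI)
  fix x assume x: "\<forall>y. metr x y = 0"
  show "x = 0"
  proof (rule crd_eqI)
    fix b k assume k: "k < n"
    \<comment> \<open>Pairing with the basis vectors reads off all coordinates of \<open>x\<close>.\<close>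
    have e: "metr x (assemble (\<lambda>b' i. if b' = c \<and> i = k then 1 else 0)) =
      (case c of L \<Rightarrow> crd x JW k | W \<Rightarrow> - crd x JL k | JL \<Rightarrow> - crd x W k | JW \<Rightarrow> crd x L k)" for c
      using k by (cases c) (simp_all add: metr_def if_distrib[of "(*) _"] sum_negf cong: if_cong)
    show "crd x b k = crd 0 b k"
      using e[of L] e[of W] e[of JL] e[of JW] x by (cases b) simp_all
  qed
qed

lemma hypersymplectic: "hypersymplectic brk metr jmap emap"
proof (rule hypersymplecticI[where D = conn])
  show "bilinear metr" by (rule bilinear_metr)
  show "nondegenerate metr" by (rule nondegenerate_metr)
  show "metr x y = metr y x" for x y
    by (simp add: metr_def algebra_simps)
  show "linear jmap"
  proof (rule linearI; rule crd_eqI)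
    fix x y b i assume "i < n"
    then show "crd (jmap (x + y)) b i = crd (jmap x + jmap y) b i" by (cases b) simp_all
  next
    fix r x b i assume "i < n"
    then show "crd (jmap (r *\<^sub>R x)) b i = crd (r *\<^sub>R jmap x) b i" by (cases b) simp_all
  qed
  show "linear emap"
  proof (rule linearI; rule crd_eqI)
    fix x y b i assume "i < n"
    then show "crd (emap (x + y)) b i = crd (emap x + emap y) b i" by (cases b) simp_all
  next
    fix r x b i assume "i < n"
    then show "crd (emap (r *\<^sub>R x)) b i = crd (r *\<^sub>R emap x) b i" by (cases b) simp_all
  qed
  show "jmap (jmap x) = - x" for x
  proof (rule crd_eqI)
    fix b i assume "i < n"
    then show "crd (jmap (jmap x)) b i = crd (- x) b i" by (cases b) simp_all
  qed
  show "emap (emap x) = x" for x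
  proof (rule crd_eqI)
    fix b i assume "i < n"
    then show "crd (emap (emap x)) b i = crd x b i" by (cases b) simp_all
  qed
  show "jmap (emap x) = - emap (jmap x)" for x
  proof (rule crd_eqI)
    fix b i assume "i < n"
    then show "crd (jmap (emap x)) b i = crd (- emap (jmap x)) b i" by (cases b) simp_all
  qed
  show "metr (jmap x) (jmap y) = metr x y" for x y
    by (simp add: metr_def algebra_simps)
  show "metr (emap x) (emap y) = - metr x y" for x y
    by (simp add: metr_def algebra_simps flip: sum_negf)
  show "brk x y = conn x y - conn y x" for x y by (rule brk_def)
  show "metr (conn x y) z = - metr y (conn x z)" for x y z
    using act_symmetric[of x "crd y W" "crd z JW"] act_symmetric[of x "crd y JW" "crd z W"]
    by (simp add: metr_def sum_subtractf sum_negf)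
  show "conn x (jmap y) = jmap (conn x y)" for x y
  proof (rule crd_eqI)
    fix b i assume "i < n"
    then show "crd (conn x (jmap y)) b i = crd (jmap (conn x y)) b i"
      by (cases b) (simp_all add: act_def)
  qed
  show "conn x (emap y) = emap (conn x y)" for x y
  proof (rule crd_eqI)
    fix b i assume "i < n"
    then show "crd (conn x (emap y)) b i = crd (emap (conn x y)) b i"
      by (cases b) (simp_all add: act_def)
  qed
qed

section \<open>The parity obstruction\<close>

lemma not_abelian_hypersymplectic: "\<not> abelian_hypersymplectic brk g J E"
proof
  assume ab: "abelian_hypersymplectic brk g J E"
  then have "linear J" "\<And>x. J (J x) = - x"
    by (auto simp: abelian_hypersymplectic_def hypersymplectic_def)
  from even_dim_invariant_complex_structure[OF this subspace_lie_center
      abelian_hypersymplectic_center_invariant[OF ab]]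
  show False using n by (simp add: dim_center)
qed

lemma not_Kodaira_type: "\<not> Kodaira_type brk g J E"
proof
  assume K: "Kodaira_type brk g J E"
  then have "linear J" "\<And>x. J (J x) = - x" "J ` lie_center brk \<subseteq> lie_center brk"
    by (auto simp: Kodaira_type_def hypersymplectic_def)
  from even_dim_invariant_complex_structure[OF this(1,2) subspace_lie_center this(3)]
  show False using n by (simp add: dim_center)
qed

end

theorem proposition4p20:
  fixes n :: nat
  assumes "n \<ge> 2" and "CARD('n::finite) = 4 * n"
  shows "\<exists>br :: real ^ 'n \<Rightarrow> real ^ 'n \<Rightarrow> real ^ 'n.
           lie_algebra br \<and> lie_irreducible br \<and> two_step_nilpotent br \<and>
           (\<exists>g J E. hypersymplectic br g J E) \<and>
           \<not> (\<exists>g J E. abelian_hypersymplectic br g J E) \<and>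
           \<not> (\<exists>g J E. Kodaira_type br g J E)"
proof -
  have "card (UNIV \<times> {..<n} :: (block \<times> nat) set) = CARD('n)"
    by (simp add: card_cartesian_product UNIV_block assms(2))
  moreover have "finite (UNIV \<times> {..<n} :: (block \<times> nat) set)"
    by (simp add: UNIV_block)
  ultimately obtain h :: "'n \<Rightarrow> block \<times> nat" where "bij_betw h UNIV (UNIV \<times> {..<n})"
    by (metis finite_class.finite_UNIV finite_same_card_bij)
  with assms(1) interpret block_coordinates n h by unfold_locales
  show ?thesis
    using lie_algebra_axioms irreducible two_step hypersymplectic
      not_abelian_hypersymplectic not_Kodaira_type
    by blast
qed

end
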